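(* Let $\alpha,\beta,\sigma>0$ and $\mu\in\mathbb{R}$. Let $h$ be the hazard rate function of the beta normal distribution $\mathrm{BN}(\alpha,\beta,\mu,\sigma)$ and $h_{\mathrm{N}}$ the hazard rate function of the normal distribution with mean $\mu$ and standard deviation $\sigma$. Then, as $x\to\infty$, $$h(x)\sim\frac{\beta}{\sigma^2}\,x\qquad\text{and}\qquad h(x)\sim\beta\,h_{\mathrm{N}}(x).$$
   Context: $\Phi$ and $\phi$ denote the standard normal cumulative distribution function and density, $\mathrm{B}(\cdot,\cdot)$ is the beta function, and $I_y(\alpha,\beta)=\mathrm{B}(\alpha,\beta)^{-1}\int_0^y w^{\alpha-1}(1-w)^{\beta-1}\,\mathrm{d}w$ is the incomplete beta function ratio. The hazard rate function of $\mathrm{BN}(\alpha,\beta,\mu,\sigma)$ is $$h(x)=\frac{\left[\Phi\left(\frac{x-\mu}{\sigma}\right)\right]^{\alpha-1}\left[1-\Phi\left(\frac{x-\mu}{\sigma}\right)\right]^{\beta-1}\phi\left(\frac{x-\mu}{\sigma}\right)}{\sigma\,\mathrm{B}(\alpha,\beta)\left[1-I_{\Phi\left(\frac{x-\mu}{\sigma}\right)}(\alpha,\beta)\right]},\qquad x\in\mathbb{R},$$ and that of the normal distribution is $$h_{\mathrm{N}}(x)=\frac{\phi\left(\frac{x-\mu}{\sigma}\right)}{\sigma\left[1-\Phi\left(\frac{x-\mu}{\sigma}\right)\right]}.$$ $a(x)\sim b(x)$ means $a(x)/b(x)\to 1$ in the indicated limit. *)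

theory Defs
  imports "HOL-Probability.Probability" "HOL-Library.Landau_Symbols"
begin

abbreviation std_normal_cdf :: "real \<Rightarrow> real" where
  "std_normal_cdf \<equiv> cdf std_normal_distribution"

definition inc_beta_ratio :: "real \<Rightarrow> real \<Rightarrow> real \<Rightarrow> real" where
  "inc_beta_ratio y \<alpha> \<beta> =
     1 / Beta \<alpha> \<beta> * integral {0..y} (\<lambda>w. w powr (\<alpha> - 1) * (1 - w) powr (\<beta> - 1))"

definition bn_hazard :: "real \<Rightarrow> real \<Rightarrow> real \<Rightarrow> real \<Rightarrow> real \<Rightarrow> real" where
  "bn_hazard \<alpha> \<beta> \<mu> \<sigma> x =
     (std_normal_cdf ((x - \<mu>) / \<sigma>) powr (\<alpha> - 1)
       * (1 - std_normal_cdf ((x - \<mu>) / \<sigma>)) powr (\<beta> - 1)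
       * std_normal_density ((x - \<mu>) / \<sigma>))
     / (\<sigma> * Beta \<alpha> \<beta> * (1 - inc_beta_ratio (std_normal_cdf ((x - \<mu>) / \<sigma>)) \<alpha> \<beta>))"

definition normal_hazard :: "real \<Rightarrow> real \<Rightarrow> real \<Rightarrow> real" where
  "normal_hazard \<mu> \<sigma> x =
     std_normal_density ((x - \<mu>) / \<sigma>) / (\<sigma> * (1 - std_normal_cdf ((x - \<mu>) / \<sigma>)))"

end

theory Submission
  imports Defs "HOL-Real_Asymp.Real_Asymp"
begin

text \<open>
  Write \<open>z = (x - \<mu>) / \<sigma>\<close> and \<open>y = \<Phi> z\<close>. The hazard rate \<open>h x\<close> is the hazard rate of the
  beta distribution at \<open>y\<close>, multiplied by the derivative \<open>\<phi> z / \<sigma>\<close> of the change of variables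
  from \<open>x\<close> to \<open>y\<close>, and \<open>y\<close> tends to \<open>1\<close> from the left.
  Near \<open>1\<close> the factor \<open>w powr (\<alpha> - 1)\<close> of the beta density is close to \<open>1\<close>, so the upper tail
  of the beta integral behaves like the integral \<open>(1 - y) powr \<beta> / \<beta>\<close> of the other factor
  (lemma \<open>Beta_tail_asymp_equiv\<close>) and the beta hazard rate like \<open>\<beta> / (1 - y)\<close>
  (lemma \<open>beta_hazard_asymp_equiv\<close>). Multiplied by \<open>\<phi> z / \<sigma>\<close>, the latter is exactly
  \<open>\<beta>\<close> times the normal hazard rate. The linear growth then follows from Mills' ratio,
  \<open>\<phi> z / (1 - \<Phi> z) \<sim> z\<close> (lemma \<open>Mills_ratio_asymp_equiv\<close>).
\<close>

section \<open>Mills ratio of the normal distribution\<close>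

lemma one_minus_std_normal_cdf:
  "ennreal (1 - std_normal_cdf z) =
     (\<integral>\<^sup>+t. ennreal (std_normal_density t) * indicator {z..} t \<partial>lborel)"
proof -
  interpret real_distribution std_normal_distribution
    by (rule real_dist_normal_dist)
  have "1 - std_normal_cdf z = prob (space std_normal_distribution - {..z})"
    by (subst prob_compl) (auto simp: cdf_def2)
  also have "space std_normal_distribution - {..z} = {z<..}"
    by auto
  finally have "ennreal (1 - std_normal_cdf z) = emeasure std_normal_distribution {z<..}"
    by (simp add: emeasure_eq_measure)
  also have "\<dots> = (\<integral>\<^sup>+t. ennreal (std_normal_density t) * indicator {z<..} t \<partial>lborel)"
    by (subst emeasure_density) auto
  also have "\<dots> = (\<integral>\<^sup>+t. ennreal (std_normal_density t) * indicator {z..} t \<partial>lborel)"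
    by (intro nn_integral_cong_AE AE_I[where N="{z}"]) (auto split: split_indicator)
  finally show ?thesis .
qed

text \<open>
  The function \<open>- \<phi> t / t\<close> vanishes at infinity and has derivative \<open>\<phi> t * (1 + 1 / t\<^sup>2)\<close>, in
  which the second factor lies between \<open>1\<close> and \<open>1 + 1 / z\<^sup>2\<close> for \<open>t \<ge> z\<close>.
\<close>

lemma Mills_ratio_bounds:
  fixes z :: real
  assumes z: "z > 0"
  shows "1 - std_normal_cdf z \<le> std_normal_density z / z"
    and "std_normal_density z / z \<le> (1 + 1 / z\<^sup>2) * (1 - std_normal_cdf z)"
proof -
  interpret real_distribution std_normal_distribution
    by (rule real_dist_normal_dist)
  have Q0: "0 \<le> 1 - std_normal_cdf z"
    using cdf_bounded_prob[of z] by simp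
  let ?f = "\<lambda>t::real. std_normal_density t * (1 + 1 / t\<^sup>2)"
  have "(\<integral>\<^sup>+t. ennreal (?f t) * indicator {z..} t \<partial>lborel) = 0 - (- std_normal_density z / z)"
  proof (rule nn_integral_FTC_atLeast)
    show "((\<lambda>t. - std_normal_density t / t) has_real_derivative ?f t) (at t)" if "z \<le> t" for t
    proof -
      have "((\<lambda>t. exp (- t\<^sup>2 / 2)) has_real_derivative - t * exp (- t\<^sup>2 / 2)) (at t)"
        by (auto intro!: derivative_eq_intros)
      from DERIV_cmult[OF this, of "1 / sqrt (2 * pi)"]
      have "(std_normal_density has_real_derivative - t * std_normal_density t) (at t)"
        unfolding std_normal_density_def[abs_def] by (simp add: mult_ac)
      then show ?thesis
        using that z by (auto intro!: derivative_eq_intros simp: field_simps power2_eq_square)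
    qed
    show "((\<lambda>t. - std_normal_density t / t) \<longlongrightarrow> 0) at_top"
      unfolding std_normal_density_def by real_asymp
  qed auto
  then have I: "(\<integral>\<^sup>+t. ennreal (?f t) * indicator {z..} t \<partial>lborel) =
      ennreal (std_normal_density z / z)"
    by simp
  have "ennreal (1 - std_normal_cdf z) \<le> (\<integral>\<^sup>+t. ennreal (?f t) * indicator {z..} t \<partial>lborel)"
    unfolding one_minus_std_normal_cdf
    by (intro nn_integral_mono mult_right_mono ennreal_leI) (auto simp: algebra_simps)
  then show "1 - std_normal_cdf z \<le> std_normal_density z / z"
    using z unfolding I by (subst (asm) ennreal_le_iff) auto
  have "(\<integral>\<^sup>+t. ennreal (?f t) * indicator {z..} t \<partial>lborel) \<le>
      (\<integral>\<^sup>+t. ennreal (1 + 1 / z\<^sup>2) * (ennreal (std_normal_density t) * indicator {z..} t) \<partial>lborel)"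
  proof (rule nn_integral_mono)
    fix t :: real
    have "?f t \<le> (1 + 1 / z\<^sup>2) * std_normal_density t" if "z \<le> t"
    proof -
      have "1 / t\<^sup>2 \<le> 1 / z\<^sup>2"
        using that z by (intro divide_left_mono power_mono) auto
      then show ?thesis
        by (subst mult.commute) (intro mult_right_mono, auto)
    qed
    then show "ennreal (?f t) * indicator {z..} t \<le>
        ennreal (1 + 1 / z\<^sup>2) * (ennreal (std_normal_density t) * indicator {z..} t)"
      by (auto split: split_indicator simp: ennreal_mult[symmetric] simp del: ennreal_plus
               intro!: ennreal_leI)
  qed
  also have "\<dots> = ennreal (1 + 1 / z\<^sup>2) * ennreal (1 - std_normal_cdf z)"
    unfolding one_minus_std_normal_cdf by (rule nn_integral_cmult) auto
  also have "\<dots> = ennreal ((1 + 1 / z\<^sup>2) * (1 - std_normal_cdf z))"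
    by (rule ennreal_mult[symmetric]) (use Q0 in auto)
  finally show "std_normal_density z / z \<le> (1 + 1 / z\<^sup>2) * (1 - std_normal_cdf z)"
    using Q0 unfolding I by (subst (asm) ennreal_le_iff) auto
qed

lemma std_normal_cdf_less_1:
  assumes "z > 0"
  shows "std_normal_cdf z < 1"
proof -
  have "0 < std_normal_density z / z"
    using assms by (simp add: normal_density_pos)
  also have "\<dots> \<le> (1 + 1 / z\<^sup>2) * (1 - std_normal_cdf z)"
    by (rule Mills_ratio_bounds(2)[OF assms])
  finally show ?thesis
    using assms by (auto simp: zero_less_mult_iff add_pos_nonneg)
      (smt (verit) zero_le_divide_1_iff zero_le_power2)
qed

lemma Mills_ratio_asymp_equiv:
  "(\<lambda>z. std_normal_density z / (1 - std_normal_cdf z)) \<sim>[at_top] (\<lambda>z. z)"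
proof (rule asymp_equiv_sandwich_real)
  show "(\<lambda>z::real. z) \<sim>[at_top] (\<lambda>z. z)"
    by simp
  show "(\<lambda>z::real. z * (1 + 1 / z\<^sup>2)) \<sim>[at_top] (\<lambda>z. z)"
    by real_asymp
  show "\<forall>\<^sub>F z in at_top. std_normal_density z / (1 - std_normal_cdf z)
          \<in> {z..z * (1 + 1 / z\<^sup>2)}"
    using eventually_gt_at_top[of 0]
  proof eventually_elim
    case (elim z)
    have "0 < 1 - std_normal_cdf z"
      using std_normal_cdf_less_1[OF elim] by simp
    then show ?case
      using Mills_ratio_bounds[OF elim] elim
      by (simp add: pos_le_divide_eq pos_divide_le_eq mult_ac)
  qed
qed

lemma std_normal_cdf_at_left_1: "filterlim std_normal_cdf (at_left 1) at_top"
proof -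
  interpret real_distribution std_normal_distribution
    by (rule real_dist_normal_dist)
  show ?thesis
    unfolding filterlim_at
    using cdf_lim_at_top_prob
    by (auto intro: eventually_mono[OF eventually_gt_at_top[of 0]] dest!: std_normal_cdf_less_1)
qed

section \<open>Upper tail and hazard rate of the beta distribution\<close>

text \<open>
  On \<open>{y..1}\<close> the monotone factor \<open>w powr (a - 1)\<close> lies between its values at the end points;
  which of the two is the larger depends on whether \<open>a \<ge> 1\<close>. The other factor has the
  explicit antiderivative \<open>- (1 - w) powr b / b\<close>; for \<open>b < 1\<close> it is continuous
  but not differentiable at \<open>1\<close>.
\<close>

lemma Beta_tail_bounds:
  fixes a b y :: real
  assumes ab: "a > 0" "b > 0" and y: "0 < y" "y < 1"
  defines "T \<equiv> integral {y..1} (\<lambda>w. w powr (a - 1) * (1 - w) powr (b - 1))"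
  shows "min 1 (y powr (a - 1)) * ((1 - y) powr b / b) \<le> T"
    and "T \<le> max 1 (y powr (a - 1)) * ((1 - y) powr b / b)"
proof -
  let ?f = "\<lambda>w::real. w powr (a - 1) * (1 - w) powr (b - 1)"
  have "?f integrable_on {0..1}"
    using has_integral_Beta_real[OF ab] by (rule has_integral_integrable)
  then have "?f integrable_on {y..1}"
    by (rule integrable_subinterval_real) (use y in auto)
  then have f: "(?f has_integral T) {y..1}"
    unfolding T_def by (rule integrable_integral)
  have "((\<lambda>w. (1 - w) powr (b - 1)) has_integral
          (- ((1 - 1) powr b / b) - - ((1 - y) powr b / b))) {y..1}"
  proof (rule fundamental_theorem_of_calculus_interior)
    show "continuous_on {y..1} (\<lambda>w. - ((1 - w) powr b / b))"
      using ab by (intro continuous_intros continuous_on_powr') auto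
    show "((\<lambda>w. - ((1 - w) powr b / b)) has_vector_derivative (1 - w) powr (b - 1)) (at w)"
      if "w \<in> {y<..<1}" for w
      using that ab unfolding has_real_derivative_iff_has_vector_derivative[symmetric]
      by (auto intro!: derivative_eq_intros simp: powr_diff field_simps)
  qed (use y in auto)
  then have g: "((\<lambda>w. c * (1 - w) powr (b - 1)) has_integral c * ((1 - y) powr b / b)) {y..1}"
    for c
    by (intro has_integral_mult_right) simp
  have "min 1 (y powr (a - 1)) \<le> w powr (a - 1) \<and> w powr (a - 1) \<le> max 1 (y powr (a - 1))"
    if "w \<in> {y..1}" for w
  proof (cases "a \<ge> 1")
    case True
    then show ?thesis
      using that y powr_mono2[of "a - 1" y w] powr_mono2[of "a - 1" w 1] by auto
  next
    case False
    then show ?thesis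
      using that y powr_mono2'[of "a - 1" y w] powr_mono2'[of "a - 1" w 1] by auto
  qed
  then show "min 1 (y powr (a - 1)) * ((1 - y) powr b / b) \<le> T"
    and "T \<le> max 1 (y powr (a - 1)) * ((1 - y) powr b / b)"
    by (intro has_integral_le[OF g f] has_integral_le[OF f g] mult_right_mono; simp)+
qed

lemma Beta_tail_asymp_equiv:
  fixes a b :: real
  assumes ab: "a > 0" "b > 0"
  shows "(\<lambda>y. integral {y..1} (\<lambda>w. w powr (a - 1) * (1 - w) powr (b - 1)))
           \<sim>[at_left 1] (\<lambda>y. (1 - y) powr b / b)"
proof (rule asymp_equiv_sandwich_real)
  have p: "((\<lambda>y::real. y powr (a - 1)) \<longlongrightarrow> 1) (at_left 1)"
    by (rule tendsto_eq_intros refl | simp)+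
  have "((\<lambda>y::real. min 1 (y powr (a - 1))) \<longlongrightarrow> 1) (at_left 1)"
    using tendsto_min[OF tendsto_const[of 1] p] by simp
  then have "(\<lambda>y::real. min 1 (y powr (a - 1))) \<sim>[at_left 1] (\<lambda>_. 1)"
    by (rule tendsto_imp_asymp_equiv_const) simp
  from asymp_equiv_mult[OF this asymp_equiv_refl[of "\<lambda>y. (1 - y) powr b / b"]]
  show "(\<lambda>y. min 1 (y powr (a - 1)) * ((1 - y) powr b / b))
          \<sim>[at_left 1] (\<lambda>y. (1 - y) powr b / b)"
    by simp
  have "((\<lambda>y::real. max 1 (y powr (a - 1))) \<longlongrightarrow> 1) (at_left 1)"
    using tendsto_max[OF tendsto_const[of 1] p] by simp
  then have "(\<lambda>y::real. max 1 (y powr (a - 1))) \<sim>[at_left 1] (\<lambda>_. 1)"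
    by (rule tendsto_imp_asymp_equiv_const) simp
  from asymp_equiv_mult[OF this asymp_equiv_refl[of "\<lambda>y. (1 - y) powr b / b"]]
  show "(\<lambda>y. max 1 (y powr (a - 1)) * ((1 - y) powr b / b))
          \<sim>[at_left 1] (\<lambda>y. (1 - y) powr b / b)"
    by simp
  show "\<forall>\<^sub>F y in at_left 1. integral {y..1} (\<lambda>w. w powr (a - 1) * (1 - w) powr (b - 1))
          \<in> {min 1 (y powr (a - 1)) * ((1 - y) powr b / b)..
             max 1 (y powr (a - 1)) * ((1 - y) powr b / b)}"
    using eventually_at_left_real[of 0 "1::real"]
    by (auto elim!: eventually_mono simp del: times_divide_eq_right intro!: Beta_tail_bounds ab)
qed

lemma Beta_times_one_minus_inc_beta_ratio:
  assumes ab: "a > 0" "b > 0" and y: "0 \<le> y" "y \<le> 1"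
  shows "Beta a b * (1 - inc_beta_ratio y a b) =
           integral {y..1} (\<lambda>w. w powr (a - 1) * (1 - w) powr (b - 1))"
proof -
  let ?f = "\<lambda>w::real. w powr (a - 1) * (1 - w) powr (b - 1)"
  have B: "(?f has_integral Beta a b) {0..1}"
    by (rule has_integral_Beta_real[OF ab])
  have "Beta a b > 0"
    using ab by (simp add: Beta_def)
  moreover have "integral {0..y} ?f + integral {y..1} ?f = Beta a b"
    using Henstock_Kurzweil_Integration.integral_combine[OF y has_integral_integrable[OF B]]
      integral_unique[OF B] by simp
  ultimately show ?thesis
    unfolding inc_beta_ratio_def by (simp add: right_diff_distrib)
qed

lemma beta_hazard_asymp_equiv:
  fixes a b :: real
  assumes ab: "a > 0" "b > 0"
  shows "(\<lambda>y. y powr (a - 1) * (1 - y) powr (b - 1) / (Beta a b * (1 - inc_beta_ratio y a b)))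
           \<sim>[at_left 1] (\<lambda>y. b / (1 - y))"
proof -
  have ev: "\<forall>\<^sub>F y in at_left 1. y \<in> {0<..<1::real}"
    by (rule eventually_at_left_real) simp
  have "((\<lambda>y::real. y powr (a - 1)) \<longlongrightarrow> 1) (at_left 1)"
    by (rule tendsto_eq_intros refl | simp)+
  then have "(\<lambda>y::real. y powr (a - 1)) \<sim>[at_left 1] (\<lambda>_. 1)"
    by (rule tendsto_imp_asymp_equiv_const) simp
  then have "(\<lambda>y. y powr (a - 1) * (1 - y) powr (b - 1) /
                integral {y..1} (\<lambda>w. w powr (a - 1) * (1 - w) powr (b - 1)))
      \<sim>[at_left 1] (\<lambda>y. 1 * (1 - y) powr (b - 1) / ((1 - y) powr b / b))"
    by (intro asymp_equiv_divide asymp_equiv_mult Beta_tail_asymp_equiv ab asymp_equiv_refl)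
  then show ?thesis
  proof (rule asymp_equiv_transfer)
    show "\<forall>\<^sub>F y in at_left 1. y powr (a - 1) * (1 - y) powr (b - 1) /
            integral {y..1} (\<lambda>w. w powr (a - 1) * (1 - w) powr (b - 1)) =
          y powr (a - 1) * (1 - y) powr (b - 1) / (Beta a b * (1 - inc_beta_ratio y a b))"
      using ev by eventually_elim (simp add: Beta_times_one_minus_inc_beta_ratio ab)
    show "\<forall>\<^sub>F y in at_left 1. 1 * (1 - y) powr (b - 1) / ((1 - y) powr b / b) = b / (1 - y)"
      using ev by eventually_elim (simp add: powr_diff)
  qed
qed

section \<open>Hazard rate of the beta normal distribution\<close>

theorem mainTheorem6:
  fixes \<alpha> \<beta> \<mu> \<sigma> :: real
  assumes "\<alpha> > 0" and "\<beta> > 0" and "\<sigma> > 0"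
  shows "bn_hazard \<alpha> \<beta> \<mu> \<sigma> \<sim>[at_top] (\<lambda>x. \<beta> / \<sigma>\<^sup>2 * x) \<and>
         bn_hazard \<alpha> \<beta> \<mu> \<sigma> \<sim>[at_top] (\<lambda>x. \<beta> * normal_hazard \<mu> \<sigma> x)"
proof -
  have z: "filterlim (\<lambda>x. (x - \<mu>) / \<sigma>) at_top at_top"
    using assms(3) by real_asymp
  have "(\<lambda>x. std_normal_cdf ((x - \<mu>) / \<sigma>) powr (\<alpha> - 1)
          * (1 - std_normal_cdf ((x - \<mu>) / \<sigma>)) powr (\<beta> - 1)
          / (Beta \<alpha> \<beta> * (1 - inc_beta_ratio (std_normal_cdf ((x - \<mu>) / \<sigma>)) \<alpha> \<beta>))
          * (std_normal_density ((x - \<mu>) / \<sigma>) / \<sigma>))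
      \<sim>[at_top] (\<lambda>x. \<beta> / (1 - std_normal_cdf ((x - \<mu>) / \<sigma>))
          * (std_normal_density ((x - \<mu>) / \<sigma>) / \<sigma>))"
    by (intro asymp_equiv_mult asymp_equiv_refl
      asymp_equiv_compose'[OF beta_hazard_asymp_equiv[OF assms(1,2)]
        filterlim_compose[OF std_normal_cdf_at_left_1 z]])
  then have normal: "bn_hazard \<alpha> \<beta> \<mu> \<sigma> \<sim>[at_top] (\<lambda>x. \<beta> * normal_hazard \<mu> \<sigma> x)"
    by (simp add: bn_hazard_def[abs_def] normal_hazard_def mult_ac)
  have "(\<lambda>x. \<beta> / \<sigma> * (std_normal_density ((x - \<mu>) / \<sigma>) / (1 - std_normal_cdf ((x - \<mu>) / \<sigma>))))
      \<sim>[at_top] (\<lambda>x. \<beta> / \<sigma> * ((x - \<mu>) / \<sigma>))"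
    by (intro asymp_equiv_mult asymp_equiv_refl asymp_equiv_compose'[OF Mills_ratio_asymp_equiv z])
  then have "(\<lambda>x. \<beta> * normal_hazard \<mu> \<sigma> x) \<sim>[at_top] (\<lambda>x. \<beta> / \<sigma> * ((x - \<mu>) / \<sigma>))"
    by (simp add: normal_hazard_def mult_ac)
  also have "\<dots> \<sim>[at_top] (\<lambda>x. \<beta> / \<sigma>\<^sup>2 * x)"
  proof (rule asymp_equivI')
    show "((\<lambda>x. (\<beta> / \<sigma> * ((x - \<mu>) / \<sigma>)) / (\<beta> / \<sigma>\<^sup>2 * x)) \<longlongrightarrow> 1) at_top"
      using assms by (real_asymp simp: power2_eq_square)
  qed
  finally show ?thesis
    using normal asymp_equiv_trans by blast
qed

end
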